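(* Let $c>\frac{1}{\ln^2 2}$ be a constant and let $T=c\,n\ln n$ (rounded to an integer). Then there is a label-less randomized protocol which succeeds on the star graph with a root and $n$ leaves in time $T$ with probability $1-o(1)$ as $n\to\infty$. That is, for each $n$ there is a probability distribution over subsets of $\{0,1,\dots,T-1\}$ such that, if each leaf $v$ independently picks a set $S_v$ from this distribution and transmits exactly at the times in $S_v$, then with probability $1-o(1)$ the rumors of all leaves reach the root.
   Context: Star graph: a root together with $n$ children, all of which are leaves; edges are directed towards the root. Each leaf holds a rumor to be delivered to the root. Time is discrete; if exactly one leaf transmits at step $t$ then the root receives its rumor, and if two or more leaves transmit at the same step (a collision) the root receives nothing. Leaves receive no information. Nodes have no labels, so a label-less randomized protocol running in time $T$ is equivalent to a probability distribution over subsets of $\{0,1,\dots,T-1\}$: each leaf $v$ independently picks a set $S_v$ of transmission times from this common distribution. The rumor of leaf $v$ reaches the root if and only if there is a time $t\in S_v$ with $t\notin S_w$ for all leaves $w\neq v$. The protocol succeeds if the rumors of all leaves reach the root. *)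

theory Defs
  imports "HOL-Probability.Probability"
begin

text \<open>
  Star graph with leaf set \<open>L\<close>; leaf \<open>v\<close> transmits exactly at the times in \<open>S v\<close>.
  At time \<open>t\<close> the root receives the rumor of \<open>v\<close> iff \<open>v\<close> is the only leaf transmitting.
\<close>

definition rumor_reaches_root :: "'v set \<Rightarrow> ('v \<Rightarrow> nat set) \<Rightarrow> 'v \<Rightarrow> bool" where
  "rumor_reaches_root L S v \<longleftrightarrow> (\<exists>t\<in>S v. \<forall>w\<in>L. w \<noteq> v \<longrightarrow> t \<notin> S w)"

definition gathering_succeeds :: "'v set \<Rightarrow> ('v \<Rightarrow> nat set) \<Rightarrow> bool" where
  "gathering_succeeds L S \<longleftrightarrow> (\<forall>v\<in>L. rumor_reaches_root L S v)"

definition labelless_protocol :: "nat \<Rightarrow> nat set pmf \<Rightarrow> bool" where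
  "labelless_protocol T D \<longleftrightarrow> set_pmf D \<subseteq> Pow {0..<T}"

text \<open>
  The leaves are numbered \<open>0, \<dots>, n - 1\<close> only to name the independent choices; all of them draw
  from the same distribution \<open>D\<close>. Outside the leaf set, \<^const>\<open>Pi_pmf\<close> returns the dummy
  value \<open>{}\<close>, which no definition above inspects.
\<close>

definition star_success_prob :: "nat \<Rightarrow> nat set pmf \<Rightarrow> real" where
  "star_success_prob n D =
     measure_pmf.prob (Pi_pmf {..<n} {} (\<lambda>_. D)) {S. gathering_succeeds {..<n} S}"

end

theory Submission
  imports Defs "HOL-Real_Asymp.Real_Asymp"
begin

text \<open>
  Cut the time line into \<open>k\<close> consecutive blocks of length \<open>m \<approx> n / ln 2\<close> and let every leaf transmit
  exactly once per block, at a uniformly random position. In one block a given leaf collides with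
  probability \<open>1 - (1 - 1/m)\<^bsup>n-1\<^esup> \<approx> 1/2\<close>, and the blocks are independent, so its rumor is lost with
  probability about \<open>2\<^bsup>-k\<^esup>\<close>, where \<open>k \<approx> T/m \<approx> c ln 2 ln n\<close>. This is \<open>n\<close> to the power
  \<open>- c (ln 2)\<^sup>2 < -1\<close>, and a union bound over the leaves finishes the proof.
\<close>

section \<open>Block schedules and the protocol\<close>

definition block_schedule :: "nat \<Rightarrow> nat \<Rightarrow> (nat \<Rightarrow> nat) \<Rightarrow> nat set" where
  "block_schedule k m f = (\<lambda>j. j * m + f j) ` {..<k}"

text \<open>For \<open>m > 0\<close>, distinct functions in the extensional space give distinct
  schedules, so this is the law of independent uniform positions in the \<open>k\<close> blocks.
  Being uniform on a finite set, it lets independent draws be handled by counting.\<close>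

definition block_protocol :: "nat \<Rightarrow> nat \<Rightarrow> nat set pmf" where
  "block_protocol k m = pmf_of_set (block_schedule k m ` ({..<k} \<rightarrow>\<^sub>E {..<m}))"

text \<open>
  A configuration \<open>G\<close> is indexed by the block first and the leaf second, so that the blocks become
  the factors of a product of sets.
\<close>

definition block_configs :: "nat \<Rightarrow> nat \<Rightarrow> nat \<Rightarrow> (nat \<Rightarrow> nat \<Rightarrow> nat) set" where
  "block_configs n k m = {..<k} \<rightarrow>\<^sub>E ({..<n} \<rightarrow>\<^sub>E {..<m})"

text \<open>Transposes the index order from block first to leaf first. The value \<open>{}\<close>
  off the leaf set agrees with the default value of \<open>Pi_pmf\<close>.\<close>

definition config_schedules :: "nat \<Rightarrow> nat \<Rightarrow> nat \<Rightarrow> (nat \<Rightarrow> nat \<Rightarrow> nat) \<Rightarrow> nat \<Rightarrow> nat set" where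
  "config_schedules n k m G v = (if v < n then block_schedule k m (\<lambda>j. G j v) else {})"

lemma mult_add_eq_iff:
  fixes a b i j m :: nat
  assumes "a < m" "b < m"
  shows "i * m + a = j * m + b \<longleftrightarrow> i = j \<and> a = b"
proof
  assume eq: "i * m + a = j * m + b"
  have "(i * m + a) div m = i" "(j * m + b) div m = j"
    using assms by auto
  with eq show "i = j \<and> a = b" by auto
qed auto

text \<open>A time determines its block and its offset as quotient and remainder modulo
  \<open>m\<close>.\<close>

lemma mem_block_schedule_iff:
  assumes "\<And>i. i < k \<Longrightarrow> f i < m" "a < m"
  shows "j * m + a \<in> block_schedule k m f \<longleftrightarrow> j < k \<and> f j = a"
  using assms by (auto simp: block_schedule_def mult_add_eq_iff)

lemma block_schedule_cong:
  "(\<And>j. j < k \<Longrightarrow> f j = g j) \<Longrightarrow> block_schedule k m f = block_schedule k m g"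
  by (auto simp: block_schedule_def)

lemma block_schedule_eqD:
  assumes "block_schedule k m f = block_schedule k m g"
    and "\<And>i. i < k \<Longrightarrow> f i < m" "\<And>i. i < k \<Longrightarrow> g i < m" "j < k"
  shows "f j = g j"
  using assms mem_block_schedule_iff[of k f m "f j" j] mem_block_schedule_iff[of k g m "f j" j]
  by auto

lemma block_schedule_subset:
  assumes "\<And>i. i < k \<Longrightarrow> f i < m"
  shows "block_schedule k m f \<subseteq> {..<k * m}"
proof -
  have "j * m + f j < k * m" if "j < k" for j
  proof -
    have "j * m + f j < Suc j * m" using assms[OF that] by simp
    also have "\<dots> \<le> k * m" using that by (intro mult_le_mono1) simp
    finally show ?thesis .
  qed
  thus ?thesis by (auto simp: block_schedule_def)
qed

lemma labelless_block_protocol: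
  assumes "m > 0" "k * m \<le> T"
  shows "labelless_protocol T (block_protocol k m)"
proof -
  have "finite ({..<k} \<rightarrow>\<^sub>E {..<m})" "({..<k} \<rightarrow>\<^sub>E {..<m}) \<noteq> {}"
    using assms by (auto simp: PiE_eq_empty_iff intro!: finite_PiE)
  hence "set_pmf (block_protocol k m) = block_schedule k m ` ({..<k} \<rightarrow>\<^sub>E {..<m})"
    by (simp add: block_protocol_def)
  moreover have "block_schedule k m f \<subseteq> {0..<T}" if "f \<in> {..<k} \<rightarrow>\<^sub>E {..<m}" for f
  proof -
    have "block_schedule k m f \<subseteq> {..<k * m}"
      using that by (intro block_schedule_subset) auto
    thus ?thesis using assms(2) by auto
  qed
  ultimately show ?thesis unfolding labelless_protocol_def by blast
qed

section \<open>Configurations as the joint probability space\<close>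

lemma block_configs_less:
  "G \<in> block_configs n k m \<Longrightarrow> j < k \<Longrightarrow> v < n \<Longrightarrow> G j v < m"
  by (auto simp: block_configs_def dest!: PiE_mem)

lemma finite_block_configs: "finite (block_configs n k m)"
  by (auto simp: block_configs_def intro!: finite_PiE)

lemma block_configs_nonempty: "m > 0 \<Longrightarrow> block_configs n k m \<noteq> {}"
  by (auto simp: block_configs_def PiE_eq_empty_iff)

lemma card_block_configs: "card (block_configs n k m) = (m ^ n) ^ k"
  by (simp add: block_configs_def card_PiE)

text \<open>Each schedule reveals the position chosen in every block, hence injectivity; conversely,
  one position function per leaf can be transposed into a configuration. The bijection makes the
  joint law of the leaves uniform on \<open>block_configs\<close>.\<close>

lemma bij_betw_config_schedules:
  "bij_betw (config_schedules n k m) (block_configs n k m)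
     (PiE_dflt {..<n} {} (\<lambda>_. block_schedule k m ` ({..<k} \<rightarrow>\<^sub>E {..<m})))"
  unfolding bij_betw_def
proof (intro conjI inj_onI equalityI subsetI)
  fix G H
  assume GH: "G \<in> block_configs n k m" "H \<in> block_configs n k m"
    and eq: "config_schedules n k m G = config_schedules n k m H"
  have entry: "G j v = H j v" if "j < k" "v < n" for j v
  proof (rule block_schedule_eqD[of k m "\<lambda>j. G j v" "\<lambda>j. H j v"])
    show "block_schedule k m (\<lambda>j. G j v) = block_schedule k m (\<lambda>j. H j v)"
      using fun_cong[OF eq, of v] that by (simp add: config_schedules_def)
  qed (use GH that block_configs_less in auto)
  show "G = H"
  proof (rule PiE_ext)
    show "G \<in> {..<k} \<rightarrow>\<^sub>E ({..<n} \<rightarrow>\<^sub>E {..<m})" "H \<in> {..<k} \<rightarrow>\<^sub>E ({..<n} \<rightarrow>\<^sub>E {..<m})"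
      using GH by (simp_all add: block_configs_def)
    show "G j = H j" if "j \<in> {..<k}" for j
    proof (rule PiE_ext)
      show "G j \<in> {..<n} \<rightarrow>\<^sub>E {..<m}" "H j \<in> {..<n} \<rightarrow>\<^sub>E {..<m}"
        using GH that by (auto simp: block_configs_def dest: PiE_mem)
    qed (use entry that in auto)
  qed
next
  fix S
  assume "S \<in> config_schedules n k m ` block_configs n k m"
  then obtain G where G: "G \<in> block_configs n k m" "S = config_schedules n k m G" by auto
  have "block_schedule k m (\<lambda>j. G j v) \<in> block_schedule k m ` ({..<k} \<rightarrow>\<^sub>E {..<m})"
    if "v < n" for v
  proof (rule image_eqI)
    \<comment> \<open>For \<open>j \<ge> k\<close>, \<open>G j v\<close> is
      \<open>undefined v\<close>, which need not be \<open>undefined\<close>. The restriction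
      restores extensionality without changing the schedule.\<close>
    show "block_schedule k m (\<lambda>j. G j v) = block_schedule k m (\<lambda>j\<in>{..<k}. G j v)"
      by (rule block_schedule_cong) simp
    show "(\<lambda>j\<in>{..<k}. G j v) \<in> {..<k} \<rightarrow>\<^sub>E {..<m}"
      using block_configs_less[OF G(1)] that by auto
  qed
  thus "S \<in> PiE_dflt {..<n} {} (\<lambda>_. block_schedule k m ` ({..<k} \<rightarrow>\<^sub>E {..<m}))"
    by (auto simp: G(2) PiE_dflt_def config_schedules_def)
next
  fix S
  assume S: "S \<in> PiE_dflt {..<n} {} (\<lambda>_. block_schedule k m ` ({..<k} \<rightarrow>\<^sub>E {..<m}))"
  hence "\<forall>v\<in>{..<n}. \<exists>f. f \<in> ({..<k} \<rightarrow>\<^sub>E {..<m}) \<and> S v = block_schedule k m f"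
    by (auto simp: PiE_dflt_def image_iff Bex_def)
  then obtain f where f: "\<And>v. v < n \<Longrightarrow> f v \<in> {..<k} \<rightarrow>\<^sub>E {..<m}"
      "\<And>v. v < n \<Longrightarrow> S v = block_schedule k m (f v)"
    by (metis lessThan_iff)
  \<comment> \<open>The transpose of \<open>f\<close>, restricted in both arguments to be
    extensional.\<close>
  define G where "G = (\<lambda>j\<in>{..<k}. \<lambda>v\<in>{..<n}. f v j)"
  have "f v j < m" if "v < n" "j < k" for v j
    using PiE_mem[OF f(1)[OF that(1)], of j] that by simp
  hence "G \<in> block_configs n k m"
    by (auto simp: G_def block_configs_def restrict_PiE_iff)
  moreover have "S = config_schedules n k m G"
  proof
    fix v
    show "S v = config_schedules n k m G v"
      using S f(2)[of v] block_schedule_cong[of k "f v" "\<lambda>j. G j v" m]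
      by (auto simp: config_schedules_def G_def PiE_dflt_def)
  qed
  ultimately show "S \<in> config_schedules n k m ` block_configs n k m" by blast
qed

lemma Pi_pmf_block_protocol:
  assumes "m > 0"
  shows "Pi_pmf {..<n} {} (\<lambda>_. block_protocol k m) =
           map_pmf (config_schedules n k m) (pmf_of_set (block_configs n k m))"
proof -
  have "({..<k} \<rightarrow>\<^sub>E {..<m}) \<noteq> {}"
    using assms by (auto simp: PiE_eq_empty_iff)
  hence "Pi_pmf {..<n} {} (\<lambda>_. block_protocol k m) =
          pmf_of_set (PiE_dflt {..<n} {} (\<lambda>_. block_schedule k m ` ({..<k} \<rightarrow>\<^sub>E {..<m})))"
    unfolding block_protocol_def by (intro Pi_pmf_of_set) (auto intro!: finite_PiE)
  also have "\<dots> = map_pmf (config_schedules n k m) (pmf_of_set (block_configs n k m))"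
    using bij_betw_config_schedules[of n k m] block_configs_nonempty[OF assms]
    by (simp add: map_pmf_of_set_inj finite_block_configs bij_betw_def)
  finally show ?thesis .
qed

section \<open>Loss probability of a single rumor\<close>

text \<open>Times from different blocks never coincide, so two leaves can only collide by choosing
  the same position in the same block.\<close>

lemma rumor_reaches_root_config_iff:
  assumes "G \<in> block_configs n k m" "v < n"
  shows "rumor_reaches_root {..<n} (config_schedules n k m G) v \<longleftrightarrow>
           (\<exists>j<k. \<forall>w<n. w \<noteq> v \<longrightarrow> G j w \<noteq> G j v)"
proof -
  have "j * m + G j v \<in> block_schedule k m (\<lambda>i. G i w) \<longleftrightarrow> G j w = G j v"
    if "j < k" "w < n" for j w
    using block_configs_less[OF assms(1)] that assms(2) by (subst mem_block_schedule_iff) auto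
  thus ?thesis
    using assms(2)
    by (auto simp: rumor_reaches_root_def config_schedules_def block_schedule_def[of k m "\<lambda>j. G j v"])
qed

text \<open>Choose the position \<open>x\<close> of \<open>v\<close> in \<open>m\<close> ways; each
  of the other \<open>n - 1\<close> leaves then has \<open>m - 1\<close> positions avoiding
  \<open>x\<close>. Injecting these choices into the collision-free assignments gives the
  bound.\<close>

lemma card_collision_free_ge:
  assumes "v < n"
  shows "m * (m - 1) ^ (n - 1) \<le>
           card {g \<in> {..<n} \<rightarrow>\<^sub>E {..<m}. \<forall>w<n. w \<noteq> v \<longrightarrow> g w \<noteq> g v}"
proof -
  define A where "A = (SIGMA x:{..<m}. ({..<n} - {v}) \<rightarrow>\<^sub>E ({..<m} - {x}))"
  have "card A = (\<Sum>x<m. card (({..<n} - {v}) \<rightarrow>\<^sub>E ({..<m} - {x})))"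
    unfolding A_def by (intro card_SigmaI) (auto intro!: finite_PiE)
  also have "\<dots> = m * (m - 1) ^ (n - 1)"
    using assms by (simp add: card_PiE)
  finally have "card A = m * (m - 1) ^ (n - 1)" .
  moreover have "card A \<le> card {g \<in> {..<n} \<rightarrow>\<^sub>E {..<m}. \<forall>w<n. w \<noteq> v \<longrightarrow> g w \<noteq> g v}"
  proof (rule card_inj_on_le)
    show "inj_on (\<lambda>(x, h). h(v := x)) A"
      \<comment> \<open>\<open>inj_combinator\<close> covers the full product of positions and
        assignments, which contains the dependent sum \<open>A\<close>.\<close>
      by (rule inj_on_subset[OF inj_combinator[of v "{..<n} - {v}" "\<lambda>_. {..<m}"]])
         (auto simp: A_def PiE_iff)
    show "(\<lambda>(x, h). h(v := x)) ` A \<subseteq>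
            {g \<in> {..<n} \<rightarrow>\<^sub>E {..<m}. \<forall>w<n. w \<noteq> v \<longrightarrow> g w \<noteq> g v}"
    proof
      fix g
      assume "g \<in> (\<lambda>(x, h). h(v := x)) ` A"
      then obtain x h where g: "g = h(v := x)"
        and xh: "x < m" "h \<in> ({..<n} - {v}) \<rightarrow>\<^sub>E ({..<m} - {x})"
        by (auto simp: A_def)
      have h: "h w < m" "h w \<noteq> x" if "w < n" "w \<noteq> v" for w
        using PiE_mem[OF xh(2), of w] that by auto
      have "h w = undefined" if "\<not> w < n" for w
        using PiE_arb[OF xh(2), of w] that by auto
      with h xh(1) assms have "g \<in> {..<n} \<rightarrow>\<^sub>E {..<m}"
        unfolding g by (intro PiE_I) auto
      with h show "g \<in> {g \<in> {..<n} \<rightarrow>\<^sub>E {..<m}. \<forall>w<n. w \<noteq> v \<longrightarrow> g w \<noteq> g v}"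
        by (simp add: g)
    qed
    have "finite ({..<n} \<rightarrow>\<^sub>E {..<m})" by (intro finite_PiE) auto
    thus "finite {g \<in> {..<n} \<rightarrow>\<^sub>E {..<m}. \<forall>w<n. w \<noteq> v \<longrightarrow> g w \<noteq> g v}" by simp
  qed
  ultimately show ?thesis by simp
qed

text \<open>The rumor is lost iff every block has a collision at \<open>v\<close>. These
  configurations form a product over the blocks, so the probability is the \<open>k\<close>-th power
  of the share of assignments outside \<open>free\<close>.\<close>

lemma prob_rumor_lost_le:
  assumes "v < n" "m > 0"
  shows "measure_pmf.prob (Pi_pmf {..<n} {} (\<lambda>_. block_protocol k m))
           {S. \<not> rumor_reaches_root {..<n} S v} \<le> (1 - (1 - 1 / real m) ^ (n - 1)) ^ k"
proof -
  define free where "free = {g \<in> {..<n} \<rightarrow>\<^sub>E {..<m}. \<forall>w<n. w \<noteq> v \<longrightarrow> g w \<noteq> g v}"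
  have fin: "finite ({..<n} \<rightarrow>\<^sub>E {..<m})" by (intro finite_PiE) auto
  have "free \<subseteq> {..<n} \<rightarrow>\<^sub>E {..<m}" by (auto simp: free_def)
  hence "card free \<le> m ^ n"
    using card_mono[OF fin] by (simp add: card_PiE)
  have lost: "block_configs n k m \<inter>
      config_schedules n k m -` {S. \<not> rumor_reaches_root {..<n} S v} =
      {..<k} \<rightarrow>\<^sub>E (({..<n} \<rightarrow>\<^sub>E {..<m}) - free)"
  proof (intro equalityI subsetI)
    fix G
    assume "G \<in> block_configs n k m \<inter>
      config_schedules n k m -` {S. \<not> rumor_reaches_root {..<n} S v}"
    hence G: "G \<in> block_configs n k m" and "\<forall>j<k. \<exists>w<n. w \<noteq> v \<and> G j w = G j v"
      using rumor_reaches_root_config_iff[OF _ assms(1)] by auto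
    thus "G \<in> {..<k} \<rightarrow>\<^sub>E (({..<n} \<rightarrow>\<^sub>E {..<m}) - free)"
      by (auto simp: block_configs_def free_def PiE_iff[of _ "{..<k}"])
  next
    fix G
    assume G: "G \<in> {..<k} \<rightarrow>\<^sub>E (({..<n} \<rightarrow>\<^sub>E {..<m}) - free)"
    hence conf: "G \<in> block_configs n k m"
      by (auto simp: block_configs_def PiE_iff[of _ "{..<k}"])
    have "\<exists>w<n. w \<noteq> v \<and> G j w = G j v" if "j < k" for j
      using PiE_mem[OF G, of j] that by (auto simp: free_def)
    with conf show "G \<in> block_configs n k m \<inter>
      config_schedules n k m -` {S. \<not> rumor_reaches_root {..<n} S v}"
      using rumor_reaches_root_config_iff[OF conf assms(1)] by auto
  qed
  \<comment> \<open>As \<open>v < n\<close> forces \<open>n > 0\<close>, one factor \<open>m\<close>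
    splits off; it cancels the choice of the position of \<open>v\<close>.\<close>
  have split: "real m ^ n = real m * real m ^ (n - 1)"
    using assms(1) by (cases n) auto
  have "real m * (real m - 1) ^ (n - 1) = real (m * (m - 1) ^ (n - 1))"
    using assms(2) by (simp add: of_nat_diff)
  also have "\<dots> \<le> real (card free)"
    using card_collision_free_ge[OF assms(1), of m] unfolding free_def by linarith
  finally have "real (card free) / real m ^ n \<ge> (real m - 1) ^ (n - 1) / real m ^ (n - 1)"
    using assms(2) by (simp add: split field_simps)
  also have "(real m - 1) ^ (n - 1) / real m ^ (n - 1) = (1 - 1 / real m) ^ (n - 1)"
    using assms(2) by (simp add: power_divide[symmetric] diff_divide_distrib)
  finally have free_ge: "(1 - 1 / real m) ^ (n - 1) \<le> real (card free) / real m ^ n" .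
  have "measure_pmf.prob (Pi_pmf {..<n} {} (\<lambda>_. block_protocol k m))
           {S. \<not> rumor_reaches_root {..<n} S v} =
        real (card ({..<k} \<rightarrow>\<^sub>E (({..<n} \<rightarrow>\<^sub>E {..<m}) - free))) / real ((m ^ n) ^ k)"
    \<comment> \<open>Deleting \<open>vimage_Collect_eq\<close> keeps the event in the preimage form
      that \<open>lost\<close> rewrites.\<close>
    by (simp add: Pi_pmf_block_protocol[OF assms(2)] measure_map_pmf measure_pmf_of_set
        finite_block_configs block_configs_nonempty[OF assms(2)] card_block_configs lost
        del: vimage_Collect_eq)
  also have "\<dots> = (real (m ^ n - card free) / real m ^ n) ^ k"
    using \<open>free \<subseteq> _\<close> fin finite_subset[OF \<open>free \<subseteq> _\<close> fin]
    by (simp add: card_PiE card_Diff_subset power_divide)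
  also have "real (m ^ n - card free) / real m ^ n = 1 - real (card free) / real m ^ n"
    using \<open>card free \<le> m ^ n\<close> assms(2) by (simp add: of_nat_diff diff_divide_distrib)
  also have "(1 - real (card free) / real m ^ n) ^ k \<le> (1 - (1 - 1 / real m) ^ (n - 1)) ^ k"
  proof (rule power_mono)
    have "real (card free) \<le> real m ^ n"
      using \<open>card free \<le> m ^ n\<close> by (metis of_nat_le_iff of_nat_power)
    thus "0 \<le> 1 - real (card free) / real m ^ n"
      using assms(2) by simp
  qed (use free_ge in simp)
  finally show ?thesis .
qed

text \<open>Union bound: failure means that at least one of the \<open>n\<close> rumors is
  lost.\<close>

lemma star_success_prob_block_protocol_ge:
  assumes "m > 0"
  shows "star_success_prob n (block_protocol k m) \<ge>
           1 - real n * (1 - (1 - 1 / real m) ^ (n - 1)) ^ k"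
proof -
  let ?M = "Pi_pmf {..<n} {} (\<lambda>_. block_protocol k m)"
  have "measure_pmf.prob ?M (- {S. gathering_succeeds {..<n} S}) =
        measure_pmf.prob ?M (\<Union>v<n. {S. \<not> rumor_reaches_root {..<n} S v})"
    by (rule arg_cong[of _ _ "measure_pmf.prob ?M"]) (auto simp: gathering_succeeds_def)
  also have "\<dots> \<le> (\<Sum>v<n. measure_pmf.prob ?M {S. \<not> rumor_reaches_root {..<n} S v})"
    by (rule measure_pmf.finite_measure_subadditive_finite) auto
  also have "\<dots> \<le> (\<Sum>v<n. (1 - (1 - 1 / real m) ^ (n - 1)) ^ k)"
    by (intro sum_mono prob_rumor_lost_le) (use assms in auto)
  also have "\<dots> = real n * (1 - (1 - 1 / real m) ^ (n - 1)) ^ k" by simp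
  finally show ?thesis
    using measure_pmf.prob_compl[of "{S. gathering_succeeds {..<n} S}" ?M]
    by (simp add: star_success_prob_def Compl_eq_Diff_UNIV)
qed

section \<open>Asymptotics of the failure bound\<close>

text \<open>The base tends to 1/2 and the exponent is asymptotic to \<open>c * ln 2 * ln x\<close>,
  so the logarithm of the whole is \<open>(1 - c * (ln 2)^2 + o(1)) * ln x\<close>. In the exponent,
  \<open>c * x * ln x - 1\<close> bounds the running time from below, \<open>x / ln 2 + 2\<close>
  bounds the block length from above, and the last \<open>- 1\<close> pays for rounding down the
  number of blocks.\<close>

lemma collision_tail_tendsto_0:
  fixes c :: real
  assumes "c > 1 / (ln 2)\<^sup>2"
  shows "((\<lambda>x::real. x * (1 - (1 - ln 2 / x) powr x) powr
            ((c * x * ln x - 1) / (x / ln 2 + 2) - 1)) \<longlongrightarrow> 0) at_top"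
proof -
  define q where "q = (\<lambda>x::real. 1 - (1 - ln 2 / x) powr x)"
  define e where "e = (\<lambda>x::real. (c * x * ln x - 1) / (x / ln 2 + 2) - 1)"
  have "ln 2 > (0::real)" by simp
  have q: "(q \<longlongrightarrow> 1 / 2) at_top"
  proof -
    have "((\<lambda>x::real. (1 - ln 2 / x) powr x) \<longlongrightarrow> exp (- ln 2)) at_top"
      by real_asymp
    hence "((\<lambda>x::real. 1 - (1 - ln 2 / x) powr x) \<longlongrightarrow> 1 - exp (- ln 2)) at_top"
      by (intro tendsto_intros)
    thus ?thesis by (simp add: q_def exp_minus)
  qed
  hence ln_q: "((\<lambda>x. ln (q x)) \<longlongrightarrow> ln (1 / 2)) at_top"
    by (intro tendsto_intros) auto
  have "((\<lambda>x. e x / ln x) \<longlongrightarrow> c * ln 2) at_top"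
    unfolding e_def using \<open>ln 2 > 0\<close> by real_asymp
  from tendsto_add[OF tendsto_const tendsto_mult[OF this ln_q], of 1]
  have "((\<lambda>x. 1 + e x / ln x * ln (q x)) \<longlongrightarrow> 1 + c * ln 2 * ln (1 / 2)) at_top"
    by (simp add: mult.assoc)
  \<comment> \<open>The left side equals \<open>1 - c * (ln 2)^2\<close>; this is where the
    hypothesis on \<open>c\<close> enters.\<close>
  moreover have "1 + c * ln 2 * ln (1 / 2) < 0"
    using assms by (simp add: ln_div field_simps power2_eq_square)
  ultimately have "LIM x at_top. (1 + e x / ln x * ln (q x)) * ln x :> at_bot"
    using ln_at_top by (rule filterlim_tendsto_neg_mult_at_bot)
  hence lim: "((\<lambda>x. exp ((1 + e x / ln x * ln (q x)) * ln x)) \<longlongrightarrow> 0) at_top"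
    by (rule filterlim_compose[OF exp_at_bot])
  have q_pos: "\<forall>\<^sub>F x in at_top. q x > 0"
    using order_tendstoD(1)[OF q, of 0] by simp
  have "\<forall>\<^sub>F x in at_top. exp ((1 + e x / ln x * ln (q x)) * ln x) = x * q x powr e x"
    \<comment> \<open>\<open>x > 1\<close> allows cancelling \<open>ln x\<close>, and
      \<open>q x > 0\<close> allows writing \<open>powr\<close> as an exponential.\<close>
    using q_pos eventually_gt_at_top[of 1]
  proof eventually_elim
    case (elim x)
    hence "(1 + e x / ln x * ln (q x)) * ln x = ln x + e x * ln (q x)"
      by (simp add: field_simps)
    with elim show ?case by (simp add: exp_add powr_def)
  qed
  with lim show ?thesis
    unfolding q_def e_def by (rule Lim_transform_eventually)
qed

section \<open>Choice of the block length and conclusion\<close>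

theorem theorem8:
  fixes c :: real and T :: "nat \<Rightarrow> nat"
  assumes "c > 1 / (ln 2)\<^sup>2"
    and "\<And>n. n \<ge> 1 \<Longrightarrow> \<bar>real (T n) - c * real n * ln (real n)\<bar> < 1"
  shows "\<exists>D :: nat \<Rightarrow> nat set pmf.
           (\<forall>n. labelless_protocol (T n) (D n)) \<and>
           (\<lambda>n. star_success_prob n (D n)) \<longlonglongrightarrow> 1"
proof -
  \<comment> \<open>With block length \<open>n / a\<close>, the loss probability behaves like
    \<open>n\<close> to the power \<open>c * a * ln (1 - exp (- a))\<close>, and
    \<open>a = ln 2\<close> minimises this exponent. The \<open>+ 1\<close> keeps \<open>m n\<close>
    positive at \<open>n = 0\<close>.\<close>
  define m where "m = (\<lambda>n::nat. nat \<lceil>real n / ln 2\<rceil> + 1)"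
  define k where "k = (\<lambda>n. T n div m n)"
  define D where "D = (\<lambda>n. block_protocol (k n) (m n))"
  define b where "b = (\<lambda>x::real. x * (1 - (1 - ln 2 / x) powr x) powr
            ((c * x * ln x - 1) / (x / ln 2 + 2) - 1))"
  have m_pos: "m n > 0" for n by (simp add: m_def)
  have "labelless_protocol (T n) (D n)" for n
    unfolding D_def by (rule labelless_block_protocol) (simp_all add: m_pos k_def)
  moreover have "(\<lambda>n. star_success_prob n (D n)) \<longlonglongrightarrow> 1"
  proof (rule tendsto_sandwich)
    have "(\<lambda>n. b (real n)) \<longlonglongrightarrow> 0"
      unfolding b_def
      by (rule filterlim_compose[OF collision_tail_tendsto_0[OF assms(1)] filterlim_real_sequentially])
    from tendsto_diff[OF tendsto_const this, of 1]
    show "(\<lambda>n. 1 - b (real n)) \<longlonglongrightarrow> 1" by simp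
    show "\<forall>\<^sub>F n in sequentially. star_success_prob n (D n) \<le> 1"
      by (simp add: star_success_prob_def)
    show "\<forall>\<^sub>F n in sequentially. 1 - b (real n) \<le> star_success_prob n (D n)"
      using eventually_ge_at_top[of 1]
    proof eventually_elim
      case (elim n)
      have ln2: "0 < ln (2::real)" "ln (2::real) < 1"
        using ln_2_less_1 by auto
      have m_bounds: "real n / ln 2 \<le> real (m n)" "real (m n) \<le> real n / ln 2 + 2"
      proof -
        have "real n / ln 2 \<ge> 0" by simp
        hence "real (m n) = of_int \<lceil>real n / ln 2\<rceil> + 1" by (simp add: m_def)
        thus "real n / ln 2 \<le> real (m n)" "real (m n) \<le> real n / ln 2 + 2"
          by linarith+
      qed
      define q where "q = 1 - (1 - ln 2 / real n) powr real n"
      have base: "0 < 1 - ln 2 / real n" "1 - ln 2 / real n < 1"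
        using elim ln2 by (auto simp: field_simps)
      have q_pow: "q = 1 - (1 - ln 2 / real n) ^ n"
        using base by (simp add: q_def powr_realpow)
      have "q > 0"
        using base elim by (simp add: q_pow power_less_one_iff)
      have "q \<le> 1" using base by (simp add: q_pow)
      have "1 / real (m n) \<le> ln 2 / real n"
        using m_bounds(1) elim ln2 m_pos[of n] by (simp add: field_simps)
      hence "(1 - ln 2 / real n) ^ (n - 1) \<le> (1 - 1 / real (m n)) ^ (n - 1)"
        using base by (intro power_mono) auto
      \<comment> \<open>Passing from \<open>n - 1\<close> to \<open>n\<close> only enlarges the
        collision bound and matches the base in \<open>b\<close>.\<close>
      moreover have "(1 - ln 2 / real n) ^ n \<le> (1 - ln 2 / real n) ^ (n - 1)"
        using base by (intro power_decreasing) auto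
      ultimately have le_q: "1 - (1 - 1 / real (m n)) ^ (n - 1) \<le> q"
        by (simp add: q_pow)
      have "(c * real n * ln (real n) - 1) / (real n / ln 2 + 2) - 1 \<le> real (k n)"
      proof -
        have "(c * real n * ln (real n) - 1) / (real n / ln 2 + 2) \<le>
                real (T n) / (real n / ln 2 + 2)"
          using assms(2)[OF elim] by (intro divide_right_mono) auto
        also have "\<dots> \<le> real (T n) / real (m n)"
          using m_bounds(2) m_pos[of n] by (intro divide_left_mono) auto
        \<comment> \<open>Integer division loses less than 1.\<close>
        also have "\<dots> \<le> real (k n) + 1"
          using floor_divide_of_nat_eq[of "T n" "m n", where 'a = real] unfolding k_def
          by linarith
        finally show ?thesis by simp
      qed
      \<comment> \<open>For \<open>0 < q \<le> 1\<close> the power decreases in its exponent, so a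
        lower bound on \<open>k n\<close> suffices. That bound is not an integer in general, hence
        \<open>powr\<close>.\<close>
      hence "q powr real (k n) \<le>
               q powr ((c * real n * ln (real n) - 1) / (real n / ln 2 + 2) - 1)"
        using \<open>q > 0\<close> \<open>q \<le> 1\<close> by (intro powr_mono') auto
      moreover have "(1 - (1 - 1 / real (m n)) ^ (n - 1)) ^ k n \<le> q powr real (k n)"
      proof -
        have "(1 - 1 / real (m n)) ^ (n - 1) \<le> 1"
          using m_pos[of n] by (intro power_le_one) auto
        hence "(1 - (1 - 1 / real (m n)) ^ (n - 1)) ^ k n \<le> q ^ k n"
          using le_q by (intro power_mono) auto
        thus ?thesis using \<open>q > 0\<close> by (simp add: powr_realpow)
      qed
      ultimately have "real n * (1 - (1 - 1 / real (m n)) ^ (n - 1)) ^ k n \<le> b (real n)"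
        unfolding b_def q_def by (intro mult_left_mono) auto
      thus ?case
        using star_success_prob_block_protocol_ge[OF m_pos[of n], of n "k n"] by (simp add: D_def)
    qed
  qed simp
  ultimately show ?thesis by blast
qed

end
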